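(* Let $d\ge 1$ and let $A=\limsup_{n\to\infty}A(n)\subset[0,1]^d$ be a limsup random fractal associated to $\{Z_n(Q): n\ge 1, Q\in\mathcal{Q}_n\}$, with indices $\gamma_1,\gamma_2$, and satisfying the Correlation Condition with constant $\delta\ge 0$. Then for any analytic set $G\subset[0,1]^d$, \[ \mathbb{P}(A\cap G\ne\varnothing)= \begin{cases} 0 & \text{if } \dim_{\mathrm P}(G)<\gamma_1,\\ 1 & \text{if } \dim_{\mathrm H}(G)>\gamma_2+\delta. \end{cases} \]
   Context: $\dim_{\mathrm H}$ and $\dim_{\mathrm P}$ denote Hausdorff and packing dimension in $\mathbb{R}^d$. For $n\ge 0$, $\mathcal{Q}_n$ is the collection of closed dyadic hyper-cubes of order $n$ in $[0,1]^d$: \[\mathcal{Q}_n=\{[k_12^{-n},(k_1+1)2^{-n}]\times\dots\times[k_d2^{-n},(k_d+1)2^{-n}] : k_i\in\mathbb{Z},\ 0\le k_i\le 2^n-1,\ 1\le i\le d\}.\] Limsup random fractal: for $n\ge 1$ let $\{Z_n(Q): Q\in\mathcal{Q}_n\}$ be random variables, all defined on one probability space $(\Omega,\mathscr{B},\mathbb{P})$ and taking values in $\{0,1\}$ (no independence is assumed). Put $A(n)=\bigcup_{Q\in\mathcal{Q}_n,\ Z_n(Q)=1}Q$ and $A=\limsup_{n\to\infty}A(n)=\bigcap_{k\ge1}\bigcup_{n\ge k}A(n)$. The random set $A$ is called the limsup random fractal associated to $\{Z_n(Q): n\ge1, Q\in\mathcal{Q}_n\}$. Indices: with $P_n(Q)=\mathbb{P}(Z_n(Q)=1)$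 and the convention $\log_2 0=-\infty$, \[\gamma_1=-\limsup_{n\to\infty}\frac{\log_2(\max_{Q\in\mathcal{Q}_n}P_n(Q))}{n},\qquad \gamma_2=-\limsup_{n\to\infty}\frac{\log_2(\min_{Q\in\mathcal{Q}_n}P_n(Q))}{n}\] (these may equal $+\infty$). Correlation Condition with constant $\delta\ge0$: for all $\epsilon>0$, $\limsup_{n\to\infty}\frac1n\log_2 f(n,\epsilon)\le\delta$, where \[f(n,\epsilon)=\max_{Q\in\mathcal{Q}_n}\#\{Q'\in\mathcal{Q}_n : \mathrm{Cov}(Z_n(Q),Z_n(Q'))\ge\epsilon P_n(Q)P_n(Q')\}\] and $\mathrm{Cov}$ denotes covariance. *)

theory Defs
  imports "HOL-Probability.Probability"
begin

section \<open>Hausdorff dimension\<close>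

text \<open>
  The convention is \<open>0 ^ 0 = 1\<close> for nonempty sets (whereas \<open>0 powr 0 = 0\<close>), so that the
  zero-dimensional Hausdorff measure is counting measure.
\<close>

definition hausdorff_gauge :: "real \<Rightarrow> 'a::metric_space set \<Rightarrow> ennreal" where
  "hausdorff_gauge s U =
     (if U = {} then 0 else if s = 0 then 1 else ennreal (diameter U powr s))"

text \<open>Boundedness is required because \<^const>\<open>diameter\<close> is meaningless on unbounded sets.\<close>

definition hausdorff_premeasure :: "real \<Rightarrow> real \<Rightarrow> 'a::metric_space set \<Rightarrow> ennreal" where
  "hausdorff_premeasure \<eta> s S =
     (INF U \<in> {U :: nat \<Rightarrow> 'a set. S \<subseteq> (\<Union>i. U i) \<and> (\<forall>i. bounded (U i) \<and> diameter (U i) \<le> \<eta>)}.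
        \<Sum>i. hausdorff_gauge s (U i))"

definition hausdorff_measure :: "real \<Rightarrow> 'a::metric_space set \<Rightarrow> ennreal" where
  "hausdorff_measure s S = (SUP \<eta> \<in> {0<..}. hausdorff_premeasure \<eta> s S)"

definition hausdorff_dim :: "'a::metric_space set \<Rightarrow> ereal" where
  "hausdorff_dim S = Inf {ereal s |s. 0 \<le> s \<and> hausdorff_measure s S = 0}"

section \<open>Packing dimension\<close>

text \<open>
  An \<open>\<eta>\<close>-packing of \<open>S\<close> is a countable family of pairwise disjoint closed balls centred in \<open>S\<close>,
  given by their centres and radii, of diameter at most \<open>\<eta>\<close>. The diameter of a ball of radius
  \<open>r\<close> in Euclidean space is \<open>2 * r\<close>.
\<close>

definition is_packing :: "real \<Rightarrow> 'a::euclidean_space set \<Rightarrow> ('a \<times> real) set \<Rightarrow> bool" where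
  "is_packing \<eta> S C \<longleftrightarrow>
     countable C \<and> (\<forall>(x, r) \<in> C. x \<in> S \<and> 0 < r \<and> 2 * r \<le> \<eta>) \<and>
     pairwise (\<lambda>(x, r) (y, t). disjnt (cball x r) (cball y t)) C"

definition packing_premeasure :: "real \<Rightarrow> 'a::euclidean_space set \<Rightarrow> ennreal" where
  "packing_premeasure s S =
     (INF \<eta> \<in> {0<..}. SUP C \<in> {C. is_packing \<eta> S C}. \<Sum>\<^sub>\<infinity>(x, r)\<in>C. ennreal ((2 * r) powr s))"

definition packing_measure :: "real \<Rightarrow> 'a::euclidean_space set \<Rightarrow> ennreal" where
  "packing_measure s S =
     (INF T \<in> {T :: nat \<Rightarrow> 'a set. S \<subseteq> (\<Union>i. T i)}. \<Sum>i. packing_premeasure s (T i))"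

definition packing_dim :: "'a::euclidean_space set \<Rightarrow> ereal" where
  "packing_dim S = Inf {ereal s |s. 0 \<le> s \<and> packing_measure s S = 0}"

section \<open>Analytic sets\<close>

text \<open>
  The continuous images of Baire space (\<^typ>\<open>nat \<Rightarrow> nat\<close> with the product topology), together
  with the empty set.
\<close>

definition analytic_set :: "'a::topological_space set \<Rightarrow> bool" where
  "analytic_set S \<longleftrightarrow>
     S = {} \<or> (\<exists>f :: (nat \<Rightarrow> nat) \<Rightarrow> 'a. continuous_on UNIV f \<and> S = range f)"

section \<open>Limsup random fractals\<close>

definition dyadic_cubes :: "nat \<Rightarrow> (real ^ 'd) set set" where
  "dyadic_cubes n =
     {cbox (\<chi> i. of_int (k i) / 2 ^ n) (\<chi> i. (of_int (k i) + 1) / 2 ^ n) |k :: 'd \<Rightarrow> int.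
        \<forall>i. 0 \<le> k i \<and> k i \<le> 2 ^ n - 1}"

definition fractal_level ::
    "(nat \<Rightarrow> (real ^ 'd) set \<Rightarrow> 'w \<Rightarrow> real) \<Rightarrow> nat \<Rightarrow> 'w \<Rightarrow> (real ^ 'd) set" where
  "fractal_level Z n \<omega> = \<Union> {Q \<in> dyadic_cubes n. Z n Q \<omega> = 1}"

definition limsup_fractal ::
    "(nat \<Rightarrow> (real ^ 'd) set \<Rightarrow> 'w \<Rightarrow> real) \<Rightarrow> 'w \<Rightarrow> (real ^ 'd) set" where
  "limsup_fractal Z \<omega> = (\<Inter>k\<in>{1..}. \<Union>n\<in>{k..}. fractal_level Z n \<omega>)"

definition hit_prob ::
    "'w measure \<Rightarrow> (nat \<Rightarrow> (real ^ 'd) set \<Rightarrow> 'w \<Rightarrow> real) \<Rightarrow> nat \<Rightarrow> (real ^ 'd) set \<Rightarrow> real" where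
  "hit_prob M Z n Q = \<P>(\<omega> in M. Z n Q \<omega> = 1)"

definition log2_ext :: "real \<Rightarrow> ereal" where
  "log2_ext x = (if x = 0 then -\<infinity> else ereal (log 2 x))"

definition index_max ::
    "'w measure \<Rightarrow> (nat \<Rightarrow> (real ^ 'd) set \<Rightarrow> 'w \<Rightarrow> real) \<Rightarrow> ereal" where
  "index_max M Z =
     - limsup (\<lambda>n. log2_ext (Max (hit_prob M Z n ` dyadic_cubes n)) / ereal (real n))"

definition index_min ::
    "'w measure \<Rightarrow> (nat \<Rightarrow> (real ^ 'd) set \<Rightarrow> 'w \<Rightarrow> real) \<Rightarrow> ereal" where
  "index_min M Z =
     - limsup (\<lambda>n. log2_ext (Min (hit_prob M Z n ` dyadic_cubes n)) / ereal (real n))"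

definition covariance :: "'w measure \<Rightarrow> ('w \<Rightarrow> real) \<Rightarrow> ('w \<Rightarrow> real) \<Rightarrow> real" where
  "covariance M X Y =
     (LINT \<omega>|M. (X \<omega> - integral\<^sup>L M X) * (Y \<omega> - integral\<^sup>L M Y))"

definition correlation_count ::
    "'w measure \<Rightarrow> (nat \<Rightarrow> (real ^ 'd) set \<Rightarrow> 'w \<Rightarrow> real) \<Rightarrow> nat \<Rightarrow> real \<Rightarrow> nat" where
  "correlation_count M Z n \<epsilon> =
     Max ((\<lambda>Q. card {Q' \<in> dyadic_cubes n.
                 covariance M (Z n Q) (Z n Q') \<ge> \<epsilon> * hit_prob M Z n Q * hit_prob M Z n Q'})
          ` dyadic_cubes n)"

definition correlation_condition ::
    "'w measure \<Rightarrow> (nat \<Rightarrow> (real ^ 'd) set \<Rightarrow> 'w \<Rightarrow> real) \<Rightarrow> real \<Rightarrow> bool" where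
  "correlation_condition M Z \<delta> \<longleftrightarrow>
     (\<forall>\<epsilon>>0. limsup (\<lambda>n. log2_ext (real (correlation_count M Z n \<epsilon>)) / ereal (real n)) \<le> ereal \<delta>)"

end

theory Submission
  imports Defs
begin

text \<open>
  If the packing dimension of \<open>G\<close> is below \<open>\<gamma>\<^sub>1\<close>, then \<open>G\<close> is covered by countably many sets each of
  which meets only \<open>O(2 powr (s n))\<close> cubes of order \<open>n\<close>, where \<open>s < \<gamma>\<^sub>1\<close>; the first Borel--Cantelli
  lemma applies to each of them.

  If the Hausdorff dimension of \<open>G\<close> exceeds \<open>\<gamma>\<^sub>2 + \<delta>\<close>, choose \<open>s\<close> strictly between. A set \<open>E\<close> with
  \<open>H\<^sup>s(E) > 0\<close> meets at least \<open>c 2 powr (s n)\<close> cubes of every large order \<open>n\<close>, so by the second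
  moment method some cube meeting \<open>E\<close> is selected with probability close to \<open>1\<close> along the
  orders \<open>n\<close> that realise \<open>\<gamma>\<^sub>2\<close>. Deleting from \<open>E\<close> the countably many dyadic cubes \<open>Q\<close> with
  \<open>H\<^sup>s(E \<inter> Q) = 0\<close> shows that almost surely infinitely many selected cubes \<open>Q\<close> satisfy
  \<open>H\<^sup>s(E \<inter> Q) > 0\<close>. Write \<open>G\<close> as the image of Baire space under a continuous \<open>f\<close>. The last statement
  holds almost surely for all \<open>E\<close> of the form \<open>f(U) \<inter> Q\<^sub>1 \<inter> \<dots> \<inter> Q\<^sub>k\<close> at once, with \<open>U\<close> a cylinder,
  since there are only countably many. Alternately selecting a cube and refining the cylinder
  then yields a point of Baire space whose image lies in infinitely many selected cubes.
\<close>

section \<open>Null sets of Hausdorff measures\<close>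

text \<open>The supremum over \<open>\<eta>\<close> vanishes iff every term does, and an infimum
  vanishes iff it drops below every positive \<open>e\<close>. In this form, statements about null
  and non-null sets reduce to choosing covers.\<close>

lemma hausdorff_measure_eq_0_iff:
  "hausdorff_measure s S = 0 \<longleftrightarrow>
     (\<forall>\<eta>>0. \<forall>e>0. \<exists>U :: nat \<Rightarrow> 'a::metric_space set.
        S \<subseteq> (\<Union>i. U i) \<and> (\<forall>i. bounded (U i) \<and> diameter (U i) \<le> \<eta>) \<and>
        (\<Sum>i. hausdorff_gauge s (U i)) < e)"
proof -
  have "hausdorff_measure s S = 0 \<longleftrightarrow> (\<forall>\<eta>>0. hausdorff_premeasure \<eta> s S = bot)"
    unfolding hausdorff_measure_def bot_ennreal[symmetric] SUP_bot_conv by auto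
  then show ?thesis
    unfolding hausdorff_premeasure_def INF_eq_bot_iff 
    by (auto simp: bot_ennreal conj_assoc)
qed

lemma hausdorff_measure_null_subset:
  assumes "hausdorff_measure s T = 0" and "S \<subseteq> T"
  shows "hausdorff_measure s S = 0"
  using assms unfolding hausdorff_measure_eq_0_iff by (meson order_trans)

lemma hausdorff_measure_null_UNION_nat:
  fixes T :: "nat \<Rightarrow> 'a::metric_space set"
  assumes "\<And>n. hausdorff_measure s (T n) = 0"
  shows "hausdorff_measure s (\<Union>n. T n) = 0"
  unfolding hausdorff_measure_eq_0_iff
proof (intro allI impI)
  fix \<eta> :: real and e :: ennreal
  assume "\<eta> > 0" "e > 0"
  \<comment> \<open>\<open>e\<close> may be infinite, so a positive real \<open>r\<close> below it
    is fixed; the budgets \<open>r / 2 ^ Suc n\<close> of the single sets then add up to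
    \<open>r\<close>.\<close>
  obtain r where r: "0 < r" "ennreal r < e"
  proof (cases "e = top")
    case True
    then show ?thesis using that[of 1] by simp
  next
    case False
    then have "0 < enn2real e"
      using \<open>e > 0\<close> by (simp add: enn2real_positive_iff less_top)
    moreover have "ennreal (enn2real e / 2) < e"
      using False \<open>0 < enn2real e\<close>
      by (metis ennreal_enn2real ennreal_lessI field_sum_of_halves less_add_same_cancel1 half_gt_zero less_top)
    ultimately show ?thesis using that[of "enn2real e / 2"] by simp
  qed
  have "\<exists>U :: nat \<Rightarrow> 'a set. T n \<subseteq> (\<Union>i. U i) \<and> (\<forall>i. bounded (U i) \<and> diameter (U i) \<le> \<eta>) \<and>
          (\<Sum>i. hausdorff_gauge s (U i)) < ennreal (r * (1 / 2) ^ Suc n)" for n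
  proof -
    have "0 < ennreal (r * (1 / 2) ^ Suc n)"
      using r by simp
    then show ?thesis
      using assms[of n] \<open>\<eta> > 0\<close> unfolding hausdorff_measure_eq_0_iff by blast
  qed
  then obtain U :: "nat \<Rightarrow> nat \<Rightarrow> 'a set" where
    cover: "\<And>n. T n \<subseteq> (\<Union>i. U n i)" and
    small: "\<And>n i. bounded (U n i) \<and> diameter (U n i) \<le> \<eta>" and
    sum: "\<And>n. (\<Sum>i. hausdorff_gauge s (U n i)) < ennreal (r * (1 / 2) ^ Suc n)"
    by metis
  \<comment> \<open>The pairing bijection merges the countably many covers into one
    sequence.\<close>
  define V where "V i = (case prod_decode i of (m, n) \<Rightarrow> U m n)" for i
  have "(\<Union>n. T n) \<subseteq> (\<Union>i. V i)"
  proof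
    fix x assume "x \<in> (\<Union>n. T n)"
    then obtain n i where "x \<in> U n i"
      using cover by blast
    then have "x \<in> V (prod_encode (n, i))"
      by (simp add: V_def)
    then show "x \<in> (\<Union>i. V i)" by blast
  qed
  moreover have "\<forall>i. bounded (V i) \<and> diameter (V i) \<le> \<eta>"
    using small by (simp add: V_def split: prod.split)
  moreover have "(\<Sum>i. hausdorff_gauge s (V i)) < e"
  proof -
    have "(\<Sum>i. hausdorff_gauge s (V i)) =
          (\<Sum>i. (\<lambda>(m, n). hausdorff_gauge s (U m n)) (prod_decode i))"
      by (auto simp: V_def split: prod.split intro!: arg_cong[where f = suminf])
    also have "\<dots> = (\<Sum>n. \<Sum>i. hausdorff_gauge s (U n i))"
      by (rule suminf_ennreal_2dimen) simp
    also have "\<dots> \<le> (\<Sum>n. ennreal (r * (1 / 2) ^ Suc n))"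
      using sum by (intro suminf_le) (auto intro: less_imp_le)
    also have "\<dots> = ennreal (r * 1)"
      using r by (intro suminf_ennreal_eq sums_mult power_half_series) auto
    also have "\<dots> < e" using r by simp
    finally show ?thesis .
  qed
  ultimately show "\<exists>U :: nat \<Rightarrow> 'a set. (\<Union>n. T n) \<subseteq> (\<Union>i. U i) \<and>
      (\<forall>i. bounded (U i) \<and> diameter (U i) \<le> \<eta>) \<and> (\<Sum>i. hausdorff_gauge s (U i)) < e"
    by blast
qed

lemma hausdorff_measure_empty: "hausdorff_measure s {} = 0"
  unfolding hausdorff_measure_eq_0_iff
  by (auto simp: hausdorff_gauge_def intro!: exI[of _ "\<lambda>_. {}"])

lemma hausdorff_measure_null_UNION:
  assumes "countable I" and "\<And>i. i \<in> I \<Longrightarrow> hausdorff_measure s (T i) = 0"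
  shows "hausdorff_measure s (\<Union>i\<in>I. T i) = 0"
proof (cases "I = {}")
  case False
  then have "(\<Union>i\<in>I. T i) = (\<Union>n. T (from_nat_into I n))"
    using assms(1) by (metis image_image range_from_nat_into)
  then show ?thesis
    using hausdorff_measure_null_UNION_nat[of s "\<lambda>n. T (from_nat_into I n)"] assms(2) False
    by (simp add: from_nat_into)
qed (simp add: hausdorff_measure_empty)

lemma hausdorff_measure_null_Un:
  assumes "hausdorff_measure s S = 0" and "hausdorff_measure s T = 0"
  shows "hausdorff_measure s (S \<union> T) = 0"
  using hausdorff_measure_null_UNION[of "{S, T}" s id] assms by auto

lemma hausdorff_measure_nonzero:
  assumes "0 \<le> s" and "ereal s < hausdorff_dim S"
  shows "hausdorff_measure s S \<noteq> 0"
proof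
  assume "hausdorff_measure s S = 0"
  then have "hausdorff_dim S \<le> ereal s"
    unfolding hausdorff_dim_def using assms(1) by (intro Inf_lower) auto
  then show False using assms(2) by simp
qed

section \<open>Counting dyadic cubes\<close>

abbreviation dyadic_cube :: "nat \<Rightarrow> ('d \<Rightarrow> int) \<Rightarrow> (real ^ 'd) set" where
  "dyadic_cube n k \<equiv> cbox (\<chi> i. of_int (k i) / 2 ^ n) (\<chi> i. (of_int (k i) + 1) / 2 ^ n)"

lemma dyadic_cubes_eq_image:
  "dyadic_cubes n = dyadic_cube n ` (UNIV \<rightarrow>\<^sub>E {0..2 ^ n - 1})"
  by (fastforce simp: dyadic_cubes_def)

lemma finite_dyadic_cubes: "finite (dyadic_cubes n)"
  unfolding dyadic_cubes_eq_image by (rule finite_imageI, rule finite_PiE) simp_all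

lemma countable_all_dyadic_cubes: "countable (\<Union>n. dyadic_cubes n)"
  by (rule countable_UN) (auto intro: countable_finite finite_dyadic_cubes)

lemma dyadic_cubes_cover: "cbox 0 1 \<subseteq> \<Union> (dyadic_cubes n)"
proof
  fix x :: "real ^ 'd"
  assume "x \<in> cbox 0 1"
  then have x: "0 \<le> x $ i" "x $ i \<le> 1" for i
    by (auto simp: mem_box_cart)
  \<comment> \<open>The minimum only matters for the coordinate value 1, where the floor would
    exceed the last admissible index.\<close>
  define k where "k i = min \<lfloor>2 ^ n * x $ i\<rfloor> (2 ^ n - 1)" for i
  have k: "0 \<le> k i" "k i \<le> 2 ^ n - 1" for i
    using x by (auto simp: k_def)
  have "of_int (k i) \<le> 2 ^ n * x $ i" for i
  proof -
    have "k i \<le> \<lfloor>2 ^ n * x $ i\<rfloor>" by (simp add: k_def)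
    then show ?thesis by linarith
  qed
  moreover have "2 ^ n * x $ i \<le> of_int (k i) + 1" for i
    using x[of i] by (simp add: k_def min_def; linarith)
  ultimately have "x \<in> dyadic_cube n k"
    by (simp add: mem_box_cart field_simps)
  then show "x \<in> \<Union> (dyadic_cubes n)"
    using k unfolding dyadic_cubes_def by blast
qed

lemma dyadic_cubes_nonempty: "(dyadic_cubes n :: (real ^ 'd) set set) \<noteq> {}"
proof -
  have "0 \<in> \<Union> (dyadic_cubes n :: (real ^ 'd) set set)"
    by (rule subsetD[OF dyadic_cubes_cover]) (simp add: mem_box_cart)
  then show ?thesis by blast
qed

text \<open>The Euclidean norm is estimated by the l1 norm. The factor lost against the true
  diameter does not depend on \<open>n\<close> and ends up in the constants.\<close>

lemma diameter_dyadic_cube: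
  fixes Q :: "(real ^ 'd) set"
  assumes "Q \<in> dyadic_cubes n"
  shows "bounded Q" and "diameter Q \<le> real CARD('d) / 2 ^ n"
proof -
  obtain k where Q: "Q = dyadic_cube n k"
    using assms unfolding dyadic_cubes_def by blast
  show "bounded Q" unfolding Q by simp
  show "diameter Q \<le> real CARD('d) / 2 ^ n"
  proof (rule diameter_le)
    fix x y assume "x \<in> Q" "y \<in> Q"
    then have "\<bar>(x - y) $ i\<bar> \<le> 1 / 2 ^ n" for i
      unfolding Q mem_box_cart by (simp add: add_divide_distrib abs_le_iff) (smt (verit, best))
    then have "(\<Sum>i\<in>UNIV. \<bar>(x - y) $ i\<bar>) \<le> (\<Sum>i\<in>(UNIV :: 'd set). 1 / 2 ^ n)"
      by (intro sum_mono)
    then show "norm (x - y) \<le> real CARD('d) / 2 ^ n"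
      using norm_le_l1_cart[of "x - y"] by simp
  qed simp
qed

section \<open>Numbers of cubes meeting a set, bounded by Hausdorff and packing measures\<close>

definition hitting_cubes :: "nat \<Rightarrow> (real ^ 'd) set \<Rightarrow> (real ^ 'd) set set" where
  "hitting_cubes n E = {Q \<in> dyadic_cubes n. Q \<inter> E \<noteq> {}}"

lemma finite_hitting_cubes: "finite (hitting_cubes n E)"
  unfolding hitting_cubes_def by (simp add: finite_dyadic_cubes)

text \<open>The cubes of order \<open>n\<close> meeting \<open>E\<close> cover it, and each has
  gauge at most a constant times \<open>2 powr (- s n)\<close>. Since \<open>E\<close> is not null,
  the gauge sums of fine covers stay above some \<open>e > 0\<close>, so there cannot be too few of
  these cubes.\<close>

lemma many_hitting_cubes:
  fixes E :: "(real ^ 'd) set"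
  assumes s: "0 < s" and E: "E \<subseteq> cbox 0 1" and pos: "hausdorff_measure s E \<noteq> 0"
  obtains c where "0 < c" and
    "eventually (\<lambda>n. c * 2 powr (s * real n) \<le> real (card (hitting_cubes n E))) sequentially"
proof -
  obtain \<eta> e where \<eta>: "0 < \<eta>" "0 < e" and
    no_cover: "\<And>U :: nat \<Rightarrow> (real ^ 'd) set. E \<subseteq> (\<Union>i. U i) \<Longrightarrow>
        (\<And>i. bounded (U i)) \<Longrightarrow> (\<And>i. diameter (U i) \<le> \<eta>) \<Longrightarrow>
        e \<le> (\<Sum>i. hausdorff_gauge s (U i))"
    using pos unfolding hausdorff_measure_eq_0_iff by (metis not_less)
  define D where "D = real CARD('d) powr s"
  have D: "0 < D" by (simp add: D_def)
  have bound: "e \<le> ennreal (real (card (hitting_cubes n E)) * (D / 2 powr (s * real n)))"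
    if n: "real CARD('d) / 2 ^ n \<le> \<eta>" for n
  proof -
    let ?N = "card (hitting_cubes n E)"
    obtain h where h: "bij_betw h {0..<?N} (hitting_cubes n E)"
      using ex_bij_betw_nat_finite[OF finite_hitting_cubes] by blast
    \<comment> \<open>Covers are infinite sequences, so the finite family is padded with empty sets,
      which have gauge 0.\<close>
    define U where "U i = (if i < ?N then h i else {})" for i
    have hQ: "h i \<in> dyadic_cubes n" if "i < ?N" for i
      using bij_betwE[OF h] that by (auto simp: hitting_cubes_def)
    have "E \<subseteq> (\<Union>i. U i)"
    proof
      fix x assume "x \<in> E"
      then obtain Q where "Q \<in> hitting_cubes n E" "x \<in> Q"
        using E dyadic_cubes_cover[of n] by (fastforce simp: hitting_cubes_def)
      then obtain i where "i < ?N" "x \<in> h i"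
        using bij_betw_imp_surj_on[OF h] by (metis atLeastLessThan_iff imageE)
      then show "x \<in> (\<Union>i. U i)" unfolding U_def by (auto intro!: exI[of _ i])
    qed
    moreover have "bounded (U i)" "diameter (U i) \<le> \<eta>" for i
      using diameter_dyadic_cube[OF hQ, of i] n \<eta> by (auto simp: U_def)
    ultimately have "e \<le> (\<Sum>i. hausdorff_gauge s (U i))"
      by (rule no_cover)
    also have "\<dots> = (\<Sum>i<?N. hausdorff_gauge s (U i))"
      by (intro suminf_finite) (auto simp: U_def hausdorff_gauge_def)
    also have "\<dots> \<le> (\<Sum>i<?N. ennreal (D / 2 powr (s * real n)))"
    proof (rule sum_mono)
      fix i assume "i \<in> {..<?N}"
      then have U: "U i \<in> dyadic_cubes n"
        using hQ by (simp add: U_def)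
      have "hausdorff_gauge s (U i) \<le> ennreal (diameter (U i) powr s)"
        using s by (simp add: hausdorff_gauge_def)
      also have "diameter (U i) powr s \<le> (real CARD('d) / 2 ^ n) powr s"
        using s diameter_dyadic_cube[OF U] by (intro powr_mono2) (auto intro: diameter_ge_0)
      also have "\<dots> = D / 2 powr (s * real n)"
        by (simp add: D_def powr_divide powr_powr powr_realpow[symmetric] mult.commute)
      finally show "hausdorff_gauge s (U i) \<le> ennreal (D / 2 powr (s * real n))"
        by (simp add: ennreal_leI)
    qed
    also have "\<dots> = ennreal (real ?N * (D / 2 powr (s * real n)))"
      by (subst ennreal_mult) (auto simp: ennreal_of_nat_eq_real_of_nat D less_imp_le)
    finally show ?thesis .
  qed
  have "(\<lambda>n. real CARD('d) / 2 ^ n) \<longlonglongrightarrow> 0"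
    by real_asymp
  then have ev: "eventually (\<lambda>n. real CARD('d) / 2 ^ n \<le> \<eta>) sequentially"
    using \<eta> by (auto dest!: order_tendstoD(2) elim: eventually_mono)
  \<comment> \<open>So far \<open>e\<close> could be infinite. One order with sufficiently small
    cubes gives a cover of finite gauge sum, hence a real value for \<open>e\<close>.\<close>
  then obtain n0 where "real CARD('d) / 2 ^ n0 \<le> \<eta>"
    by (auto simp: eventually_sequentially)
  then have "e < top"
    using bound by (metis ennreal_less_top order_le_less_trans)
  then obtain r where r: "e = ennreal r" "0 < r"
    using \<open>0 < e\<close> by (cases e) auto
  show ?thesis
  proof
    show "0 < r / D" using r D by simp
    show "eventually (\<lambda>n. r / D * 2 powr (s * real n) \<le> real (card (hitting_cubes n E))) sequentially"
      using ev
    proof eventually_elim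
      case (elim n)
      then have "r \<le> real (card (hitting_cubes n E)) * (D / 2 powr (s * real n))"
        using bound[of n] D unfolding r(1) by (subst (asm) ennreal_le_iff) auto
      then show ?case using D by (simp add: field_simps)
    qed
  qed
qed

text \<open>Choosing a point of \<open>T\<close> in each cube that meets it turns cubes into centres
  of a packing, once the cubes are sorted into finitely many classes of well separated ones. A
  finite premeasure bounds the packing sum, hence the number of cubes in each class.\<close>

lemma few_hitting_cubes:
  fixes T :: "(real ^ 'd) set"
  assumes fin: "packing_premeasure s T < top"
  obtains C where "0 \<le> C" and
    "eventually (\<lambda>n. real (card (hitting_cubes n T)) \<le> C * 2 powr (s * real n)) sequentially"
proof -
  obtain \<eta> where \<eta>: "0 < \<eta>" and
    "(SUP C \<in> {C. is_packing \<eta> T C}. \<Sum>\<^sub>\<infinity>(x, r)\<in>C. ennreal ((2 * r) powr s)) < top"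
    using fin unfolding packing_premeasure_def INF_less_iff by auto
  then obtain b where b: "0 \<le> b"
    "\<And>C. is_packing \<eta> T C \<Longrightarrow> (\<Sum>\<^sub>\<infinity>(x, r)\<in>C. ennreal ((2 * r) powr s)) \<le> ennreal b"
    by (metis (mono_tags, lifting) SUP_upper ennreal_cases mem_Collect_eq top.not_eq_extremum)
  \<comment> \<open>There are as many classes as parity patterns
    \<open>'d \<Rightarrow> bool\<close>. Each contributes at most \<open>b\<close> divided by
    \<open>(2 * r) powr s\<close>, whose inverse is
    \<open>(3 / 2) powr s * 2 powr (s n)\<close>.\<close>
  define c where "c = real CARD('d \<Rightarrow> bool) * (b * (3 / 2) powr s)"
  have bound: "real (card (hitting_cubes n T)) \<le> c * 2 powr (s * real n)"
    if n: "2 * (1 / (3 * 2 ^ n)) \<le> \<eta>" for n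
  proof -
    \<comment> \<open>The ball diameter \<open>2 * r\<close> is two thirds of the side length,
      strictly below the separation within a class, so even closed balls are disjoint.\<close>
    define r :: real where "r = 1 / (3 * 2 ^ n)"
    have r: "0 < r" "2 * r \<le> \<eta>" "2 * r < 1 / 2 ^ n"
      using n by (auto simp: r_def field_simps)
    have r_powr: "(2 * r) powr s * ((3 / 2) powr s * 2 powr (s * real n)) = 1"
    proof -
      have "(2 * r) powr s * ((3 / 2) powr s * 2 powr (s * real n)) =
            (2 * r) powr s * ((3 / 2) powr s * (2 powr real n) powr s)"
        by (simp add: powr_powr mult.commute)
      also have "\<dots> = (2 * r * (3 / 2 * 2 powr real n)) powr s"
        by (simp only: powr_mult mult.assoc)
      also have "2 * r * (3 / 2 * 2 powr real n) = 1"
        by (simp add: r_def powr_realpow)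
      finally show ?thesis by simp
    qed
    define K :: "('d \<Rightarrow> int) set" where
      "K = {k \<in> UNIV \<rightarrow>\<^sub>E {0..2 ^ n - 1}. dyadic_cube n k \<inter> T \<noteq> {}}"
    have "finite K"
      unfolding K_def by (rule finite_subset[OF Collect_restrict], rule finite_PiE) simp_all
    have hit: "hitting_cubes n T = dyadic_cube n ` K"
      unfolding hitting_cubes_def dyadic_cubes_eq_image K_def by blast
    have "\<forall>k\<in>K. \<exists>x. x \<in> dyadic_cube n k \<inter> T"
      unfolding K_def by blast
    then obtain x where x: "\<And>k. k \<in> K \<Longrightarrow> x k \<in> dyadic_cube n k \<inter> T"
      by metis
    \<comment> \<open>Two distinct cubes whose indices have the same parities lie at distance at least \<open>1 / 2 ^ n\<close>,
      so a parity class yields a packing by balls of radius \<open>r\<close>.\<close>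
    define Kp where "Kp p = {k \<in> K. \<forall>i. even (k i) = p i}" for p
    have KUn: "K = (\<Union>p. Kp p)"
    proof
      show "K \<subseteq> (\<Union>p. Kp p)"
      proof
        fix k assume "k \<in> K"
        then have "k \<in> Kp (\<lambda>i. even (k i))" by (simp add: Kp_def)
        then show "k \<in> (\<Union>p. Kp p)" by blast
      qed
    qed (auto simp: Kp_def)
    have card_le: "real (card (Kp p)) \<le> b * (3 / 2) powr s * 2 powr (s * real n)" for p
    proof -
      have sep: "2 * r < dist (x k) (x l)" if kl: "k \<in> Kp p" "l \<in> Kp p" "k \<noteq> l" for k l
      proof -
        obtain i where i: "k i \<noteq> l i" using kl by auto
        moreover have "even (k i) = even (l i)"
          using kl by (simp add: Kp_def)
        \<comment> \<open>Distinct integers of equal parity differ by at least 2. The scaled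
          coordinates lie in the unit intervals starting there, which leaves a gap of at least
          1.\<close>
        ultimately have "2 \<le> \<bar>k i - l i\<bar>" by presburger
        then have k2: "real_of_int (k i) + 2 \<le> of_int (l i) \<or> real_of_int (l i) + 2 \<le> of_int (k i)"
          by linarith
        have "x k \<in> dyadic_cube n k" "x l \<in> dyadic_cube n l"
          using kl x by (auto simp: Kp_def)
        then have "of_int (k i) \<le> 2 ^ n * x k $ i" "2 ^ n * x k $ i \<le> of_int (k i) + 1"
          "of_int (l i) \<le> 2 ^ n * x l $ i" "2 ^ n * x l $ i \<le> of_int (l i) + 1"
          by (auto simp: mem_box_cart field_simps)
        then have "1 \<le> \<bar>2 ^ n * x k $ i - 2 ^ n * x l $ i\<bar>"
          using k2 by linarith
        also have "\<dots> = 2 ^ n * \<bar>(x k - x l) $ i\<bar>"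
          by (simp flip: right_diff_distrib add: abs_mult)
        also have "\<dots> \<le> 2 ^ n * dist (x k) (x l)"
          unfolding dist_norm by (intro mult_left_mono component_le_norm_cart) simp
        finally have "1 / 2 ^ n \<le> dist (x k) (x l)"
          by (simp add: field_simps)
        then show ?thesis using r by linarith
      qed
      define C where "C = (\<lambda>k. (x k, r)) ` Kp p"
      have finKp: "finite (Kp p)"
        using \<open>finite K\<close> by (simp add: Kp_def)
      \<comment> \<open>A packing is a set of pairs, so distinct cubes must have distinct centres
        for the packing sum to contain \<open>card (Kp p)\<close> terms.\<close>
      have inj: "inj_on (\<lambda>k. (x k, r)) (Kp p)"
        using sep r(1) by (intro inj_onI) (metis dist_self mult_pos_pos order_less_asym prod.inject zero_less_numeral)
      have "is_packing \<eta> T C"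
        unfolding is_packing_def
      proof (intro conjI)
        show "countable C" unfolding C_def using finKp by (intro countable_image countable_finite)
        show "\<forall>(y, t)\<in>C. y \<in> T \<and> 0 < t \<and> 2 * t \<le> \<eta>"
          using x r by (auto simp: C_def Kp_def)
        show "pairwise (\<lambda>(y, t) (z, u). disjnt (cball y t) (cball z u)) C"
        proof (rule pairwiseI)
          fix a a' assume "a \<in> C" "a' \<in> C" "a \<noteq> a'"
          then obtain k l where kl: "k \<in> Kp p" "l \<in> Kp p" "k \<noteq> l" "a = (x k, r)" "a' = (x l, r)"
            unfolding C_def by blast
          have "False" if "z \<in> cball (x k) r" "z \<in> cball (x l) r" for z
            using sep[OF kl(1-3)] that dist_triangle2[of "x k" "x l" z] by (simp add: dist_commute)
          then show "(\<lambda>(y, t) (z, u). disjnt (cball y t) (cball z u)) a a'"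
            unfolding kl by (auto simp: disjnt_iff)
        qed
      qed
      then have "(\<Sum>\<^sub>\<infinity>(y, t)\<in>C. ennreal ((2 * t) powr s)) \<le> ennreal b"
        by (rule b(2))
      also have "(\<Sum>\<^sub>\<infinity>(y, t)\<in>C. ennreal ((2 * t) powr s)) =
          (\<Sum>(y, t)\<in>C. ennreal ((2 * t) powr s))"
        unfolding C_def using finKp by (intro infsum_finite finite_imageI)
      also have "\<dots> = (\<Sum>k\<in>Kp p. ennreal ((2 * r) powr s))"
        unfolding C_def by (subst sum.reindex[OF inj]) simp
      also have "\<dots> = ennreal (\<Sum>k\<in>Kp p. (2 * r) powr s)"
        by (rule sum_ennreal) simp
      finally have "real (card (Kp p)) * (2 * r) powr s \<le> b"
        using b(1) by (simp add: ennreal_le_iff)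
      then have "real (card (Kp p)) * (2 * r) powr s * ((3 / 2) powr s * 2 powr (s * real n)) \<le>
          b * ((3 / 2) powr s * 2 powr (s * real n))"
        by (rule mult_right_mono) simp
      then show ?thesis
        using r_powr by (simp add: mult.assoc)
    qed
    have "card (hitting_cubes n T) \<le> card K"
      unfolding hit by (rule card_image_le[OF \<open>finite K\<close>])
    also have "\<dots> \<le> (\<Sum>p\<in>UNIV. card (Kp p))"
      unfolding KUn by (rule card_UN_le) simp
    finally have "real (card (hitting_cubes n T)) \<le> (\<Sum>p\<in>UNIV. real (card (Kp p)))"
      unfolding of_nat_sum[symmetric] of_nat_le_iff .
    also have "\<dots> \<le> (\<Sum>p\<in>(UNIV :: ('d \<Rightarrow> bool) set). b * (3 / 2) powr s * 2 powr (s * real n))"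
      by (intro sum_mono card_le)
    also have "\<dots> = c * 2 powr (s * real n)"
      by (simp add: c_def)
    finally show ?thesis .
  qed
  have "(\<lambda>n. 2 * (1 / (3 * 2 ^ n)) :: real) \<longlonglongrightarrow> 0"
    by real_asymp
  then have "eventually (\<lambda>n. 2 * (1 / (3 * 2 ^ n)) \<le> \<eta>) sequentially"
    using \<eta> by (auto dest!: order_tendstoD(2) elim: eventually_mono)
  then have "eventually (\<lambda>n. real (card (hitting_cubes n T)) \<le> c * 2 powr (s * real n)) sequentially"
    by (rule eventually_mono) (rule bound)
  moreover have "0 \<le> c" using b by (simp add: c_def)
  ultimately show ?thesis by (rule that[rotated])
qed

text \<open>Packing measure 0 yields a countable cover whose premeasures sum to less than 1, so each
  piece has finite premeasure and \<open>few_hitting_cubes\<close> applies to it.\<close>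

lemma packing_dim_lessE:
  assumes "packing_dim S < a"
  obtains s T where "ereal s < a" "S \<subseteq> (\<Union>i :: nat. T i)" "\<And>i. packing_premeasure s (T i) < top"
proof -
  obtain s where s: "ereal s < a" "packing_measure s S = 0"
    using assms unfolding packing_dim_def Inf_less_iff by auto
  then have "packing_measure s S < 1" by simp
  then obtain T :: "nat \<Rightarrow> 'a set" where T: "S \<subseteq> (\<Union>i. T i)" "(\<Sum>i. packing_premeasure s (T i)) < 1"
    unfolding packing_measure_def INF_less_iff by blast
  have "packing_premeasure s (T i) < top" for i
    using ennreal_suminf_lessD[OF T(2)] ennreal_one_less_top by (rule order.strict_trans)
  then show ?thesis by (rule that[OF s(1) T(1)])
qed

section \<open>The second moment method\<close>

lemma log2_ext_le_powr:
  assumes "0 < n" and "0 \<le> x" and "log2_ext x / ereal (real n) < ereal a"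
  shows "x \<le> 2 powr (a * real n)"
proof (cases "x = 0")
  case False
  then have "log 2 x < a * real n"
    using assms by (simp add: log2_ext_def divide_less_eq)
  then show ?thesis
    using False assms by (simp add: log_less_iff)
qed simp

text \<open>The case \<open>x = 0\<close> is contradictory, because minus infinity lies below every
  real exponent.\<close>

lemma log2_ext_ge_powr:
  assumes "0 < n" and "0 \<le> x" and "ereal a < log2_ext x / ereal (real n)"
  shows "2 powr (a * real n) \<le> x"
proof (cases "x = 0")
  case False
  then have "a * real n < log 2 x"
    using assms by (simp add: log2_ext_def less_divide_eq)
  then show ?thesis
    using False assms by (simp add: less_log_iff)
qed (use assms in \<open>simp add: log2_ext_def\<close>)

text \<open>Chebyshev for the number \<open>X\<close> of selected cubes, with mean \<open>m\<close>.
  In the covariance sum, a fixed \<open>Q\<close> has at most \<open>F\<close> strongly correlated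
  partners, each costing at most \<open>p Q\<close>; the others together cost at most
  \<open>\<epsilon> * p Q * m\<close>. Hence the variance is at most
  \<open>\<epsilon> * m\<^sup>2 + F * m\<close>.\<close>

lemma (in prob_space) second_moment_all_zero:
  fixes Z :: "'b \<Rightarrow> 'a \<Rightarrow> real"
  assumes fin: "finite D"
    and meas: "\<And>Q. Q \<in> D \<Longrightarrow> Z Q \<in> borel_measurable M"
    and val: "\<And>Q \<omega>. Q \<in> D \<Longrightarrow> \<omega> \<in> space M \<Longrightarrow> Z Q \<omega> \<in> {0, 1}"
    and p: "\<And>Q. Q \<in> D \<Longrightarrow> p Q = \<P>(\<omega> in M. Z Q \<omega> = 1)"
    and eps: "0 \<le> \<epsilon>"
    and F: "\<And>Q. Q \<in> D \<Longrightarrow>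
      real (card {Q' \<in> D. covariance M (Z Q) (Z Q') \<ge> \<epsilon> * p Q * p Q'}) \<le> F"
    and pos: "0 < (\<Sum>Q\<in>D. p Q)"
  shows "\<P>(\<omega> in M. \<forall>Q\<in>D. Z Q \<omega> = 0) \<le> \<epsilon> + F / (\<Sum>Q\<in>D. p Q)"
proof -
  define m where "m = (\<Sum>Q\<in>D. p Q)"
  define X where "X \<omega> = (\<Sum>Q\<in>D. Z Q \<omega>)" for \<omega>
  have [measurable]: "X \<in> borel_measurable M"
    unfolding X_def using meas by (intro borel_measurable_sum)
  have p_nonneg: "0 \<le> p Q" if "Q \<in> D" for Q using p that by simp
  have abs_le: "\<bar>Z Q \<omega>\<bar> \<le> 1" if "Q \<in> D" "\<omega> \<in> space M" for Q \<omega>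
    using val[OF that] by auto
  have intZ: "integrable M (Z Q)" if "Q \<in> D" for Q
    using abs_le that meas by (intro integrable_const_bound[where B = 1]) (auto intro!: AE_I2)
  have EZ: "expectation (Z Q) = p Q" if Q: "Q \<in> D" for Q
  proof -
    have [measurable]: "Z Q \<in> borel_measurable M" using meas Q .
    have "expectation (Z Q) = expectation (indicator {\<omega> \<in> space M. Z Q \<omega> = 1})"
      using val[OF Q] by (intro Bochner_Integration.integral_cong) (auto simp: indicator_def)
    then show ?thesis using p[OF Q] by simp
  qed
  have intZZ: "integrable M (\<lambda>\<omega>. Z Q \<omega> * Z Q' \<omega>)" if "Q \<in> D" "Q' \<in> D" for Q Q'
    using abs_le that meas
    by (intro integrable_const_bound[where B = 1]) (auto intro!: AE_I2 mult_le_one simp: abs_mult)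
  have int_cov: "integrable M (\<lambda>\<omega>. (Z Q \<omega> - p Q) * (Z Q' \<omega> - p Q'))"
    if "Q \<in> D" "Q' \<in> D" for Q Q'
    using intZZ[OF that] intZ[OF that(1)] intZ[OF that(2)]
    by (simp add: left_diff_distrib right_diff_distrib)
  have cov: "covariance M (Z Q) (Z Q') = (LINT \<omega>|M. (Z Q \<omega> - p Q) * (Z Q' \<omega> - p Q'))"
    if "Q \<in> D" "Q' \<in> D" for Q Q'
    using EZ that by (simp add: covariance_def)
  \<comment> \<open>For variables with values 0 and 1 the product is at most either factor.\<close>
  have cov_le: "covariance M (Z Q) (Z Q') \<le> p Q" if Q: "Q \<in> D" "Q' \<in> D" for Q Q'
  proof -
    have "covariance M (Z Q) (Z Q') = expectation (\<lambda>\<omega>. Z Q \<omega> * Z Q' \<omega>) - p Q * p Q'"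
      unfolding cov[OF Q] using intZZ[OF Q] intZ[OF Q(1)] intZ[OF Q(2)] EZ[OF Q(1)] EZ[OF Q(2)]
      by (simp add: left_diff_distrib right_diff_distrib prob_space)
    also have "\<dots> \<le> expectation (\<lambda>\<omega>. Z Q \<omega> * Z Q' \<omega>)"
      using p_nonneg Q by simp
    also have "\<dots> \<le> expectation (Z Q)"
      using val[OF Q(1)] val[OF Q(2)] intZZ[OF Q] intZ[OF Q(1)]
      by (intro integral_mono) fastforce+
    finally show ?thesis using EZ Q by simp
  qed
  have EX: "expectation X = m"
    unfolding X_def m_def using intZ EZ by (simp add: Bochner_Integration.integral_sum)
  have "variance X = (LINT \<omega>|M. (\<Sum>Q\<in>D. \<Sum>Q'\<in>D. (Z Q \<omega> - p Q) * (Z Q' \<omega> - p Q')))"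
    unfolding EX by (simp add: X_def m_def sum_subtractf[symmetric] power2_eq_square sum_product)
  also have "\<dots> = (\<Sum>Q\<in>D. \<Sum>Q'\<in>D. covariance M (Z Q) (Z Q'))"
    using int_cov by (simp add: Bochner_Integration.integral_sum cov)
  also have "\<dots> \<le> (\<Sum>Q\<in>D. \<epsilon> * p Q * m + F * p Q)"
  proof (rule sum_mono)
    fix Q assume Q: "Q \<in> D"
    define B where "B = {Q' \<in> D. covariance M (Z Q) (Z Q') \<ge> \<epsilon> * p Q * p Q'}"
    have "(\<Sum>Q'\<in>D. covariance M (Z Q) (Z Q')) \<le>
        (\<Sum>Q'\<in>D. \<epsilon> * p Q * p Q' + (if Q' \<in> B then p Q else 0))"
    proof (rule sum_mono)
      fix Q' assume Q': "Q' \<in> D"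
      \<comment> \<open>Nonnegativity lets strongly correlated pairs, bounded by \<open>p Q\<close>
        alone, be absorbed in the common two-term bound.\<close>
      have "0 \<le> \<epsilon> * p Q * p Q'" using eps p_nonneg Q Q' by simp
      then show "covariance M (Z Q) (Z Q') \<le> \<epsilon> * p Q * p Q' + (if Q' \<in> B then p Q else 0)"
        using cov_le[OF Q Q'] Q' unfolding B_def by auto
    qed
    also have "\<dots> = \<epsilon> * p Q * m + real (card B) * p Q"
      using fin by (simp add: sum.distrib m_def sum_distrib_left sum.If_cases B_def Int_def)
    also have "\<dots> \<le> \<epsilon> * p Q * m + F * p Q"
      using F[OF Q] p_nonneg[OF Q] by (simp add: B_def mult_right_mono)
    finally show "(\<Sum>Q'\<in>D. covariance M (Z Q) (Z Q')) \<le> \<epsilon> * p Q * m + F * p Q" .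
  qed
  also have "\<dots> = (\<Sum>Q\<in>D. p Q) * (\<epsilon> * m) + F * (\<Sum>Q\<in>D. p Q)"
    unfolding sum.distrib sum_distrib_left sum_distrib_right by (simp add: mult_ac)
  also have "\<dots> = \<epsilon> * m\<^sup>2 + F * m"
    by (simp add: m_def[symmetric] power2_eq_square)
  finally have var: "variance X \<le> \<epsilon> * m\<^sup>2 + F * m" .
  have m: "0 < m" using pos by (simp add: m_def)
  have "integrable M (\<lambda>\<omega>. (X \<omega>)\<^sup>2)"
    unfolding X_def power2_eq_square sum_product using intZZ by (intro Bochner_Integration.integrable_sum)
  then have "prob {\<omega> \<in> space M. \<bar>X \<omega> - expectation X\<bar> \<ge> m} \<le> variance X / m\<^sup>2"
    using m by (intro Chebyshev_inequality) auto
  moreover have "\<P>(\<omega> in M. \<forall>Q\<in>D. Z Q \<omega> = 0) \<le> prob {\<omega> \<in> space M. \<bar>X \<omega> - expectation X\<bar> \<ge> m}"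
  proof (rule finite_measure_mono)
    \<comment> \<open>If no cube is selected, then \<open>X\<close> is 0 and deviates from its mean
      by exactly \<open>m\<close>.\<close>
    show "{\<omega> \<in> space M. \<forall>Q\<in>D. Z Q \<omega> = 0} \<subseteq> {\<omega> \<in> space M. \<bar>X \<omega> - expectation X\<bar> \<ge> m}"
      unfolding EX by (auto simp: X_def)
  qed measurable
  moreover have "variance X / m\<^sup>2 \<le> (\<epsilon> * m\<^sup>2 + F * m) / m\<^sup>2"
    using var by (intro divide_right_mono) auto
  moreover have "(\<epsilon> * m\<^sup>2 + F * m) / m\<^sup>2 = \<epsilon> + F / m"
    using m by (simp add: field_simps power2_eq_square)
  ultimately show ?thesis by (simp add: m_def)
qed

section \<open>Hitting events and the exponents of the selection probabilities\<close>

locale random_cubes = prob_space M for M :: "'w measure" +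
  fixes Z :: "nat \<Rightarrow> (real ^ 'd) set \<Rightarrow> 'w \<Rightarrow> real"
  assumes Z_measurable: "\<And>n Q. n \<ge> 1 \<Longrightarrow> Q \<in> dyadic_cubes n \<Longrightarrow> Z n Q \<in> borel_measurable M"
    and Z_values: "\<And>n Q \<omega>. n \<ge> 1 \<Longrightarrow> Q \<in> dyadic_cubes n \<Longrightarrow> \<omega> \<in> space M \<Longrightarrow> Z n Q \<omega> \<in> {0, 1}"
begin

text \<open>The event that \<open>fractal_level Z n\<close> meets \<open>E\<close>. Phrased through
  cubes it is a finite union of events for \<open>n \<ge> 1\<close>, so it is measurable for an
  arbitrary set \<open>E\<close>.\<close>

definition hit_event :: "nat \<Rightarrow> (real ^ 'd) set \<Rightarrow> 'w set" where
  "hit_event n E = {\<omega> \<in> space M. \<exists>Q\<in>hitting_cubes n E. Z n Q \<omega> = 1}"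

lemma single_hit_sets:
  assumes "n \<ge> 1" "Q \<in> dyadic_cubes n"
  shows "{\<omega> \<in> space M. Z n Q \<omega> = 1} \<in> events"
proof -
  have [measurable]: "Z n Q \<in> borel_measurable M" using Z_measurable assms .
  show ?thesis by measurable
qed

lemma hit_event_eq_UN: "hit_event n E = (\<Union>Q\<in>hitting_cubes n E. {\<omega> \<in> space M. Z n Q \<omega> = 1})"
  by (auto simp: hit_event_def)

lemma hit_event_sets:
  assumes "n \<ge> 1"
  shows "hit_event n E \<in> events"
  unfolding hit_event_eq_UN
  using single_hit_sets[OF assms] finite_hitting_cubes
  by (intro sets.finite_UN) (auto simp: hitting_cubes_def)

lemma hit_prob_bounds: "0 \<le> hit_prob M Z n Q" "hit_prob M Z n Q \<le> 1"
  by (auto simp: hit_prob_def)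

lemma hit_prob_le_Max: "Q \<in> dyadic_cubes n \<Longrightarrow> hit_prob M Z n Q \<le> Max (hit_prob M Z n ` dyadic_cubes n)"
  by (simp add: finite_dyadic_cubes)

lemma Min_le_hit_prob: "Q \<in> dyadic_cubes n \<Longrightarrow> Min (hit_prob M Z n ` dyadic_cubes n) \<le> hit_prob M Z n Q"
  by (simp add: finite_dyadic_cubes)

lemma Max_hit_prob_nonneg: "0 \<le> Max (hit_prob M Z n ` dyadic_cubes n)"
  using dyadic_cubes_nonempty[of n] hit_prob_bounds(1) hit_prob_le_Max order_trans by blast

lemma Min_hit_prob_nonneg: "0 \<le> Min (hit_prob M Z n ` dyadic_cubes n)"
  using dyadic_cubes_nonempty hit_prob_bounds(1)
  by (intro Min.boundedI) (auto simp: finite_dyadic_cubes)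

lemma eventually_hit_prob_le:
  assumes "ereal g < index_max M Z"
  shows "eventually (\<lambda>n. \<forall>Q\<in>dyadic_cubes n. hit_prob M Z n Q \<le> 2 powr (- g * real n)) sequentially"
proof -
  have "limsup (\<lambda>n. log2_ext (Max (hit_prob M Z n ` dyadic_cubes n)) / ereal (real n)) < ereal (- g)"
    using assms unfolding index_max_def by (subst (asm) ereal_less_uminus_reorder) simp
  then have "eventually (\<lambda>n. log2_ext (Max (hit_prob M Z n ` dyadic_cubes n)) / ereal (real n) < ereal (- g)) sequentially"
    by (rule Limsup_lessD)
  then show ?thesis
    using eventually_gt_at_top[of 0]
  proof eventually_elim
    case (elim n)
    then have "Max (hit_prob M Z n ` dyadic_cubes n) \<le> 2 powr (- g * real n)"
      by (intro log2_ext_le_powr Max_hit_prob_nonneg)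
    then show ?case using hit_prob_le_Max order_trans by blast
  qed
qed

text \<open>The index is the negative of a limsup, so a lower bound on the minimal probability is
  available only along infinitely many orders, in contrast to the upper bound for the maximal
  one.\<close>

lemma frequently_hit_prob_ge:
  assumes "index_min M Z < ereal g"
  shows "frequently (\<lambda>n. \<forall>Q\<in>dyadic_cubes n. 2 powr (- g * real n) \<le> hit_prob M Z n Q) sequentially"
proof -
  let ?f = "\<lambda>n. log2_ext (Min (hit_prob M Z n ` dyadic_cubes n)) / ereal (real n)"
  have *: "ereal (- g) < limsup ?f"
    using assms unfolding index_min_def by (subst (asm) ereal_uminus_less_reorder) simp
  have "frequently (\<lambda>n. ereal (- g) < ?f n) sequentially"
  proof (rule ccontr)
    assume "\<not> ?thesis"
    then have "eventually (\<lambda>n. ?f n \<le> ereal (- g)) sequentially"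
      by (simp add: not_frequently not_less)
    then have "limsup ?f \<le> ereal (- g)" by (rule Limsup_bounded)
    with * show False by simp
  qed
  then have "frequently (\<lambda>n. ereal (- g) < ?f n \<and> 0 < n) sequentially"
    using eventually_gt_at_top[of "0 :: nat"] by (rule frequently_eventually_frequently)
  then show ?thesis
  proof (rule frequently_elim1)
    fix n assume "ereal (- g) < ?f n \<and> 0 < n"
    then have "2 powr (- g * real n) \<le> Min (hit_prob M Z n ` dyadic_cubes n)"
      by (intro log2_ext_ge_powr Min_hit_prob_nonneg) auto
    then show "\<forall>Q\<in>dyadic_cubes n. 2 powr (- g * real n) \<le> hit_prob M Z n Q"
      using Min_le_hit_prob order_trans by blast
  qed
qed

text \<open>A negative index would force some probability above 1. This ensures that exponents above
  \<open>index_min M Z + ereal \<delta>\<close> are positive, as \<open>many_hitting_cubes\<close>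
  demands.\<close>

lemma index_min_nonneg: "0 \<le> index_min M Z"
proof (rule ccontr)
  assume "\<not> ?thesis"
  then obtain g where g: "index_min M Z < ereal g" "ereal g < 0"
    using ereal_dense2[of "index_min M Z" 0] by (auto simp: not_le)
  then have "frequently (\<lambda>n. (\<forall>Q\<in>dyadic_cubes n. 2 powr (- g * real n) \<le> hit_prob M Z n Q) \<and> 0 < n) sequentially"
    by (intro frequently_eventually_frequently frequently_hit_prob_ge eventually_gt_at_top)
  then obtain n where n: "\<forall>Q\<in>dyadic_cubes n. 2 powr (- g * real n) \<le> hit_prob M Z n Q" "0 < n"
    by (auto dest: frequently_ex)
  obtain Q :: "(real ^ 'd) set" where Q: "Q \<in> dyadic_cubes n"
    using dyadic_cubes_nonempty by blast
  have "1 < 2 powr (- g * real n)"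
    using n(2) g(2) by (simp add: mult_neg_pos)
  then show False
    using n(1) Q hit_prob_bounds(2)[of n Q] by fastforce
qed

lemma eventually_correlation_count_le:
  assumes "correlation_condition M Z \<delta>" and "\<delta> < \<delta>'" and "0 < \<epsilon>"
  shows "eventually (\<lambda>n. real (correlation_count M Z n \<epsilon>) \<le> 2 powr (\<delta>' * real n)) sequentially"
proof -
  have "limsup (\<lambda>n. log2_ext (real (correlation_count M Z n \<epsilon>)) / ereal (real n)) < ereal \<delta>'"
    using assms unfolding correlation_condition_def by (meson ereal_less(3) less_ereal.simps(1) order_le_less_trans)
  then have "eventually (\<lambda>n. log2_ext (real (correlation_count M Z n \<epsilon>)) / ereal (real n) < ereal \<delta>') sequentially"
    by (rule Limsup_lessD)
  then show ?thesis
    using eventually_gt_at_top[of 0]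
    by eventually_elim (intro log2_ext_le_powr, auto)
qed

section \<open>Almost sure avoidance of sets with finite packing premeasure\<close>

lemma AE_limsup_fractal_misses:
  assumes fin: "packing_premeasure s T < top" and s: "ereal s < index_max M Z"
  shows "AE \<omega> in M. limsup_fractal Z \<omega> \<inter> T = {}"
proof -
  \<comment> \<open>With \<open>g\<close> strictly between \<open>s\<close> and the index, the union
    bound over the hitting cubes decays like \<open>2 powr ((s - g) n)\<close>, which is
    summable.\<close>
  obtain g where g: "s < g" "ereal g < index_max M Z"
    using ereal_dense2[OF s] by auto
  obtain C where C: "0 \<le> C"
    "eventually (\<lambda>n. real (card (hitting_cubes n T)) \<le> C * 2 powr (s * real n)) sequentially"
    using few_hitting_cubes[OF fin] by blast
  have "eventually (\<lambda>n. prob (hit_event n T) \<le> C * (2 powr (s - g)) ^ n) sequentially"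
    using C(2) eventually_hit_prob_le[OF g(2)] eventually_ge_at_top[of 1]
  proof eventually_elim
    case (elim n)
    have "prob (hit_event n T) \<le> (\<Sum>Q\<in>hitting_cubes n T. prob {\<omega> \<in> space M. Z n Q \<omega> = 1})"
      unfolding hit_event_eq_UN using single_hit_sets elim(3)
      by (intro finite_measure_subadditive_finite finite_hitting_cubes) (auto simp: hitting_cubes_def)
    also have "\<dots> \<le> (\<Sum>Q\<in>hitting_cubes n T. 2 powr (- g * real n))"
      using elim(2) by (intro sum_mono) (auto simp: hitting_cubes_def hit_prob_def)
    also have "\<dots> = real (card (hitting_cubes n T)) * 2 powr (- g * real n)"
      by simp
    also have "\<dots> \<le> C * 2 powr (s * real n) * 2 powr (- g * real n)"
      using elim(1) by (intro mult_right_mono) auto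
    also have "\<dots> = C * (2 powr (s - g)) ^ n"
      by (simp add: powr_realpow[symmetric] powr_powr powr_add[symmetric] algebra_simps)
    finally show ?case .
  qed
  then have ev: "eventually (\<lambda>n. norm (prob (hit_event n T)) \<le> C * (2 powr (s - g)) ^ n) sequentially"
    by simp
  have "2 powr (s - g) < (1 :: real)"
    using powr_less_mono[of "s - g" 0 2] g(1) by simp
  then have "summable (\<lambda>n. C * (2 powr (s - g)) ^ n)"
    by (intro summable_mult summable_geometric) simp
  with ev have "summable (\<lambda>n. prob (hit_event n T))"
    by (rule summable_comparison_test_ev)
  \<comment> \<open>The shift discards order 0, about which the locale assumes nothing, so that
    every set passed to Borel--Cantelli is an event.\<close>
  then have "summable (\<lambda>n. prob (hit_event (Suc n) T))"
    by (rule summable_Suc_iff[THEN iffD2])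
  then have "AE \<omega> in M. eventually (\<lambda>n. \<omega> \<in> space M - hit_event (Suc n) T) sequentially"
    using hit_event_sets by (intro borel_cantelli_AE1) (auto simp: less_top[symmetric])
  then show ?thesis
  proof eventually_elim
    case (elim \<omega>)
    then obtain N where N: "\<And>n. n \<ge> N \<Longrightarrow> \<omega> \<in> space M - hit_event (Suc n) T"
      by (auto simp: eventually_sequentially)
    have "y \<notin> T" if y: "y \<in> limsup_fractal Z \<omega>" for y
    proof
      assume "y \<in> T"
      obtain n where n: "n \<ge> Suc N" "y \<in> fractal_level Z n \<omega>"
        using y unfolding limsup_fractal_def by auto
      then obtain Q where "Q \<in> dyadic_cubes n" "Z n Q \<omega> = 1" "y \<in> Q"
        unfolding fractal_level_def by blast
      moreover have "\<omega> \<in> space M - hit_event n T"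
        using N[of "n - 1"] n(1) by simp
      ultimately show False
        using \<open>y \<in> T\<close> unfolding hit_event_def hitting_cubes_def by blast
    qed
    then show ?case by blast
  qed
qed

section \<open>Almost sure hitting of sets with positive Hausdorff measure\<close>

lemma prob_hit_event_ge:
  assumes n: "n \<ge> 1" and eps: "0 < \<epsilon>" and E: "hitting_cubes n E \<noteq> {}"
    and q: "0 < q" "\<And>Q. Q \<in> dyadic_cubes n \<Longrightarrow> q \<le> hit_prob M Z n Q"
  shows "1 - \<epsilon> - real (correlation_count M Z n \<epsilon>) / (real (card (hitting_cubes n E)) * q)
           \<le> prob (hit_event n E)"
proof -
  let ?D = "hitting_cubes n E" and ?p = "hit_prob M Z n"
  let ?F = "real (correlation_count M Z n \<epsilon>)"
  have D: "Q \<in> dyadic_cubes n" if "Q \<in> ?D" for Q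
    using that by (simp add: hitting_cubes_def)
  have "0 < card ?D" using E finite_hitting_cubes by (simp add: card_gt_0_iff)
  then have pos: "0 < real (card ?D) * q" using q(1) by simp
  \<comment> \<open>This bounds the expected number of selected cubes meeting \<open>E\<close> from
    below; it is the denominator in the second moment estimate.\<close>
  have sum_ge: "real (card ?D) * q \<le> (\<Sum>Q\<in>?D. ?p Q)"
    using sum_bounded_below[of ?D q ?p] q(2) D by simp
  \<comment> \<open>Restricting the partners to cubes that meet \<open>E\<close> can only lower the
    count in the Correlation Condition.\<close>
  have "real (card {Q' \<in> ?D. covariance M (Z n Q) (Z n Q') \<ge> \<epsilon> * ?p Q * ?p Q'}) \<le> ?F"
    if Q: "Q \<in> ?D" for Q
  proof -
    have "card {Q' \<in> ?D. covariance M (Z n Q) (Z n Q') \<ge> \<epsilon> * ?p Q * ?p Q'} \<le>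
        card {Q' \<in> dyadic_cubes n. covariance M (Z n Q) (Z n Q') \<ge> \<epsilon> * ?p Q * ?p Q'}"
      using D by (intro card_mono) (auto simp: finite_dyadic_cubes)
    also have "\<dots> \<le> correlation_count M Z n \<epsilon>"
      unfolding correlation_count_def using D[OF Q] by (intro Max_ge) (auto simp: finite_dyadic_cubes)
    finally show ?thesis by simp
  qed
  then have "\<P>(\<omega> in M. \<forall>Q\<in>?D. Z n Q \<omega> = 0) \<le> \<epsilon> + ?F / (\<Sum>Q\<in>?D. ?p Q)"
    using Z_measurable[OF n D] Z_values[OF n D] eps pos sum_ge
    by (intro second_moment_all_zero finite_hitting_cubes) (auto simp: hit_prob_def)
  also have "?F / (\<Sum>Q\<in>?D. ?p Q) \<le> ?F / (real (card ?D) * q)"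
    using pos sum_ge by (intro divide_left_mono) auto
  finally have "\<P>(\<omega> in M. \<forall>Q\<in>?D. Z n Q \<omega> = 0) \<le> \<epsilon> + ?F / (real (card ?D) * q)"
    by simp
  moreover have "{\<omega> \<in> space M. \<forall>Q\<in>?D. Z n Q \<omega> = 0} = space M - hit_event n E"
    using Z_values[OF n D] unfolding hit_event_def by fastforce
  ultimately show ?thesis
    using prob_compl[OF hit_event_sets[OF n, of E]] by simp
qed

text \<open>The error quotient in \<open>prob_hit_event_ge\<close> is at most
  \<open>2 powr ((g + \<delta>' - s) n) / c\<close>, which tends to 0. One favourable order beyond
  \<open>N\<close> thus already gives the union of all later hitting events probability at least
  \<open>1 - 2 * \<epsilon>\<close>, for every \<open>\<epsilon>\<close>.\<close>

lemma AE_infinitely_many_hits: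
  assumes corr: "correlation_condition M Z \<delta>" and "\<delta> \<ge> 0"
    and s: "index_min M Z + ereal \<delta> < ereal s"
    and E: "E \<subseteq> cbox 0 1" "hausdorff_measure s E \<noteq> 0"
  shows "AE \<omega> in M. \<forall>N. \<exists>n\<ge>N. \<exists>Q\<in>hitting_cubes n E. Z n Q \<omega> = 1"
proof -
  \<comment> \<open>The gap below \<open>s\<close> is split in two, since both the probability
    bounds and the correlation bounds hold only for exponents strictly above their limiting
    values.\<close>
  obtain g \<delta>' where g: "index_min M Z < ereal g" and \<delta>': "\<delta> < \<delta>'" and less: "g + \<delta>' < s"
  proof -
    have "index_min M Z < ereal (s - \<delta>)"
      using s by (cases "index_min M Z") auto
    then obtain g where g: "index_min M Z < ereal g" "g < s - \<delta>"
      using ereal_dense2 by force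
    then obtain \<delta>' where "\<delta> < \<delta>'" "\<delta>' < s - g"
      using dense[of \<delta> "s - g"] by auto
    then show ?thesis using that[of g \<delta>'] g by simp
  qed
  have "0 < s"
    using g index_min_nonneg less \<delta>' \<open>\<delta> \<ge> 0\<close> by (cases "index_min M Z") auto
  obtain c where c: "0 < c"
    "eventually (\<lambda>n. c * 2 powr (s * real n) \<le> real (card (hitting_cubes n E))) sequentially"
    using many_hitting_cubes[OF \<open>0 < s\<close> E] by blast
  have "prob (\<Union>n\<in>{N..}. hit_event n E) = 1" if N: "N \<ge> 1" for N
  proof -
    have ge: "1 - 2 * \<epsilon> \<le> prob (\<Union>n\<in>{N..}. hit_event n E)" if eps: "0 < \<epsilon>" for \<epsilon>
    proof -
      have "(\<lambda>n. (2 powr (g + \<delta>' - s)) ^ n :: real) \<longlonglongrightarrow> 0"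
        using powr_less_mono[of "g + \<delta>' - s" 0 2] less by (intro LIMSEQ_power_zero) simp
      then have lim: "eventually (\<lambda>n. (2 powr (g + \<delta>' - s)) ^ n < \<epsilon> * c) sequentially"
        using eps c(1) by (intro order_tendstoD(2)) auto
      \<comment> \<open>Only the probability bound is merely frequent; the other four conditions
        hold eventually, so all of them meet at some order.\<close>
      have "frequently (\<lambda>n. (\<forall>Q\<in>dyadic_cubes n. 2 powr (- g * real n) \<le> hit_prob M Z n Q) \<and>
          ((2 powr (g + \<delta>' - s)) ^ n < \<epsilon> * c \<and>
           c * 2 powr (s * real n) \<le> real (card (hitting_cubes n E)) \<and>
           real (correlation_count M Z n \<epsilon>) \<le> 2 powr (\<delta>' * real n) \<and> N \<le> n)) sequentially"
        by (intro frequently_eventually_frequently frequently_hit_prob_ge[OF g] eventually_conj lim c(2)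
            eventually_correlation_count_le[OF corr \<delta>' eps] eventually_ge_at_top)
      then obtain n where n:
        "\<And>Q. Q \<in> dyadic_cubes n \<Longrightarrow> 2 powr (- g * real n) \<le> hit_prob M Z n Q"
        "(2 powr (g + \<delta>' - s)) ^ n < \<epsilon> * c"
        "c * 2 powr (s * real n) \<le> real (card (hitting_cubes n E))"
        "real (correlation_count M Z n \<epsilon>) \<le> 2 powr (\<delta>' * real n)" "N \<le> n"
        by (auto dest!: frequently_ex)
      have "0 < c * 2 powr (s * real n)" using c(1) by simp
      then have "hitting_cubes n E \<noteq> {}" using n(3) by force
      then have "1 - \<epsilon> - real (correlation_count M Z n \<epsilon>) /
          (real (card (hitting_cubes n E)) * 2 powr (- g * real n)) \<le> prob (hit_event n E)"
        using n(1,5) N eps by (intro prob_hit_event_ge) auto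
      moreover have "real (correlation_count M Z n \<epsilon>) /
          (real (card (hitting_cubes n E)) * 2 powr (- g * real n)) \<le>
          2 powr (\<delta>' * real n) / (c * 2 powr (s * real n) * 2 powr (- g * real n))"
        using n(3,4) c(1) by (intro frac_le mult_right_mono) auto
      moreover have "\<dots> = (2 powr (g + \<delta>' - s)) ^ n / c"
      proof -
        have "(2 powr (g + \<delta>' - s)) ^ n = 2 powr (\<delta>' * real n - s * real n - (- g * real n))"
          by (simp add: powr_realpow[symmetric] powr_powr algebra_simps)
        also have "\<dots> = 2 powr (\<delta>' * real n) / (2 powr (s * real n) * 2 powr (- g * real n))"
          by (simp only: powr_diff divide_divide_eq_left)
        finally show ?thesis by simp
      qed
      moreover have "\<dots> \<le> \<epsilon>"
        using n(2) c(1) by (simp add: divide_le_eq)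
      moreover have "prob (hit_event n E) \<le> prob (\<Union>n\<in>{N..}. hit_event n E)"
        using n(5) N hit_event_sets by (intro finite_measure_mono sets.countable_UN') auto
      ultimately show ?thesis by linarith
    qed
    have "1 \<le> prob (\<Union>n\<in>{N..}. hit_event n E)"
    proof (rule field_le_epsilon)
      fix e :: real assume "0 < e"
      then show "1 \<le> prob (\<Union>n\<in>{N..}. hit_event n E) + e"
        using ge[of "e / 2"] by simp
    qed
    then show ?thesis
      using prob_le_1 by (simp add: order_antisym)
  qed
  then have "AE \<omega> in M. \<omega> \<in> (\<Union>n\<in>{Suc N..}. hit_event n E)" for N
    using hit_event_sets by (subst prob_eq_1[symmetric]) (auto intro!: sets.countable_UN')
  then have "AE \<omega> in M. \<forall>N. \<omega> \<in> (\<Union>n\<in>{Suc N..}. hit_event n E)"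
    by (simp add: AE_all_countable)
  then show ?thesis
  proof eventually_elim
    case (elim \<omega>)
    show ?case
    proof
      fix N
      obtain n where "n \<ge> Suc N" "\<omega> \<in> hit_event n E" using elim[rule_format, of N] by auto
      then show "\<exists>n\<ge>N. \<exists>Q\<in>hitting_cubes n E. Z n Q \<omega> = 1"
        unfolding hit_event_def by (auto intro!: exI[of _ n])
    qed
  qed
qed

text \<open>The hit cube now meets \<open>E\<close> in a non-null set, so the same statement can be
  applied again to \<open>E \<inter> Q\<close>. This is what makes the later recursion
  possible.\<close>

lemma AE_infinitely_many_large_hits:
  assumes corr: "correlation_condition M Z \<delta>" and "\<delta> \<ge> 0"
    and s: "index_min M Z + ereal \<delta> < ereal s"
    and E: "E \<subseteq> cbox 0 1" "hausdorff_measure s E \<noteq> 0"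
  shows "AE \<omega> in M. \<forall>N. \<exists>n\<ge>N. \<exists>Q\<in>dyadic_cubes n. Z n Q \<omega> = 1 \<and> hausdorff_measure s (E \<inter> Q) \<noteq> 0"
proof -
  define B where "B = {Q \<in> (\<Union>n. dyadic_cubes n). hausdorff_measure s (E \<inter> Q) = 0}"
  define E' where "E' = E - \<Union> B"
  have "countable B"
    unfolding B_def by (rule countable_subset[OF Collect_restrict countable_all_dyadic_cubes])
  then have "hausdorff_measure s (\<Union>Q\<in>B. E \<inter> Q) = 0"
    by (rule hausdorff_measure_null_UNION) (simp add: B_def)
  moreover have "E \<subseteq> E' \<union> (\<Union>Q\<in>B. E \<inter> Q)"
    unfolding E'_def by blast
  ultimately have "hausdorff_measure s E' \<noteq> 0"
    using E(2) hausdorff_measure_null_Un hausdorff_measure_null_subset by metis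
  moreover have "E' \<subseteq> cbox 0 1" using E(1) by (auto simp: E'_def)
  ultimately have "AE \<omega> in M. \<forall>N. \<exists>n\<ge>N. \<exists>Q\<in>hitting_cubes n E'. Z n Q \<omega> = 1"
    using AE_infinitely_many_hits[OF corr \<open>\<delta> \<ge> 0\<close> s] by blast
  then show ?thesis
  proof eventually_elim
    case (elim \<omega>)
    \<comment> \<open>\<open>E'\<close> avoids every cube in \<open>B\<close>, so a cube meeting
      \<open>E'\<close> cannot be one of them.\<close>
    have "Q \<in> dyadic_cubes n \<and> hausdorff_measure s (E \<inter> Q) \<noteq> 0"
      if "Q \<in> hitting_cubes n E'" for n Q
      using that unfolding hitting_cubes_def E'_def B_def by blast
    then show ?case using elim by meson
  qed
qed

end

section \<open>Constructing a point of the limsup set\<close>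

definition baire_cylinder :: "nat list \<Rightarrow> (nat \<Rightarrow> nat) set" where
  "baire_cylinder u = {x. \<forall>i<length u. x i = u ! i}"

lemma baire_cylinder_Nil: "baire_cylinder [] = UNIV"
  by (simp add: baire_cylinder_def)

lemma baire_cylinder_split: "baire_cylinder u = (\<Union>m. baire_cylinder (u @ [m]))"
  by (auto simp: baire_cylinder_def nth_append less_Suc_eq)

text \<open>Each coordinate of \<open>y k\<close> is eventually constant, and convergence in the
  product topology is coordinatewise.\<close>

lemma tendsto_baire_cylinder:
  assumes "\<And>k. y k \<in> baire_cylinder (map x [0..<k])"
  shows "y \<longlonglongrightarrow> x"
proof -
  have "(\<lambda>k. y k i) \<longlonglongrightarrow> x i" for i
  proof (rule tendsto_eventually)
    show "eventually (\<lambda>k. y k i = x i) sequentially"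
      using eventually_gt_at_top[of i]
      by eventually_elim (use assms in \<open>auto simp: baire_cylinder_def\<close>)
  qed
  then show ?thesis
    using limitin_componentwise[of "\<lambda>_. euclidean" UNIV y x sequentially]
    by (simp add: euclidean_product_topology)
qed

lemma limsup_hit_construction:
  fixes f :: "(nat \<Rightarrow> nat) \<Rightarrow> real ^ 'd"
  assumes cont: "continuous_on UNIV f"
    and start: "hausdorff_measure s (range f) \<noteq> 0"
    and step: "\<And>u qs N. qs \<in> lists (\<Union>n. dyadic_cubes n) \<Longrightarrow>
        hausdorff_measure s (f ` baire_cylinder u \<inter> \<Inter> (set qs)) \<noteq> 0 \<Longrightarrow>
        \<exists>n\<ge>N. \<exists>Q\<in>dyadic_cubes n. Z n Q \<omega> = 1 \<and>
          hausdorff_measure s (f ` baire_cylinder u \<inter> \<Inter> (set qs) \<inter> Q) \<noteq> 0"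
  shows "limsup_fractal Z \<omega> \<inter> range f \<noteq> {}"
proof -
  define H where "H u qs \<longleftrightarrow> qs \<in> lists (\<Union>n. dyadic_cubes n) \<and>
      hausdorff_measure s (f ` baire_cylinder u \<inter> \<Inter> (set qs)) \<noteq> 0" for u qs
  have "\<exists>F. \<forall>k. (length (fst (F k)) = k \<and> H (fst (F k)) (snd (F k))) \<and>
     (\<exists>m n Q. fst (F (Suc k)) = fst (F k) @ [m] \<and> k \<le> n \<and> Q \<in> dyadic_cubes n \<and>
        Z n Q \<omega> = 1 \<and> snd (F (Suc k)) = Q # snd (F k))"
  proof (rule dependent_nat_choice)
    show "\<exists>S. length (fst S) = 0 \<and> H (fst S) (snd S)"
      using start by (intro exI[of _ "([], [])"]) (simp add: H_def baire_cylinder_Nil)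
  next
    fix S k assume S: "length (fst S) = k \<and> H (fst S) (snd S)"
    obtain u qs where Seq: "S = (u, qs)" by fastforce
    obtain n Q where Q: "k \<le> n" "Q \<in> dyadic_cubes n" "Z n Q \<omega> = 1"
      "hausdorff_measure s (f ` baire_cylinder u \<inter> \<Inter> (set qs) \<inter> Q) \<noteq> 0"
      using step[of qs u k] S unfolding H_def Seq by auto
    \<comment> \<open>The one-letter extensions of \<open>u\<close> are countably many and cover its
      cylinder, so they cannot all give null sets.\<close>
    have "\<exists>m. hausdorff_measure s (f ` baire_cylinder (u @ [m]) \<inter> \<Inter> (set (Q # qs))) \<noteq> 0"
    proof (rule ccontr)
      assume "\<not> ?thesis"
      then have "hausdorff_measure s (\<Union>m. f ` baire_cylinder (u @ [m]) \<inter> \<Inter> (set (Q # qs))) = 0"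
        by (intro hausdorff_measure_null_UNION_nat) auto
      moreover have "f ` baire_cylinder u \<inter> \<Inter> (set qs) \<inter> Q =
          (\<Union>m. f ` baire_cylinder (u @ [m]) \<inter> \<Inter> (set (Q # qs)))"
        by (subst baire_cylinder_split) auto
      ultimately show False using Q(4) by simp
    qed
    then obtain m where "hausdorff_measure s (f ` baire_cylinder (u @ [m]) \<inter> \<Inter> (set (Q # qs))) \<noteq> 0"
      by blast
    then have "H (u @ [m]) (Q # qs)"
      using S Q(2) unfolding H_def Seq by auto
    then show "\<exists>S'. (length (fst S') = Suc k \<and> H (fst S') (snd S')) \<and>
        (\<exists>m n Q. fst S' = fst S @ [m] \<and> k \<le> n \<and> Q \<in> dyadic_cubes n \<and>
          Z n Q \<omega> = 1 \<and> snd S' = Q # snd S)"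
      using S Q unfolding Seq by (intro exI[of _ "(u @ [m], Q # qs)"]) auto
  qed
  then obtain F where F: "\<And>k. length (fst (F k)) = k" "\<And>k. H (fst (F k)) (snd (F k))"
    "\<And>k. \<exists>m n Q. fst (F (Suc k)) = fst (F k) @ [m] \<and> k \<le> n \<and> Q \<in> dyadic_cubes n \<and>
        Z n Q \<omega> = 1 \<and> snd (F (Suc k)) = Q # snd (F k)"
    by blast
  then obtain m n Q where mnQ: "\<And>k. fst (F (Suc k)) = fst (F k) @ [m k]" "\<And>k. k \<le> n k"
    "\<And>k. Q k \<in> dyadic_cubes (n k)" "\<And>k. Z (n k) (Q k) \<omega> = 1"
    "\<And>k. snd (F (Suc k)) = Q k # snd (F k)"
    by metis
  have u: "fst (F k) = map m [0..<k]" for k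
    by (induction k) (use F(1)[of 0] mnQ(1) in auto)
  \<comment> \<open>Cubes are never removed from the list, so the \<open>j\<close>-th one constrains
    every later stage.\<close>
  have q: "Q j \<in> set (snd (F k))" if "j < k" for j k
    using that by (induction k) (auto simp: mnQ(5) less_Suc_eq)
  \<comment> \<open>Non-null sets are nonempty, which supplies witnesses for the approximating
    sequence.\<close>
  have "\<exists>z. z \<in> baire_cylinder (map m [0..<k]) \<and> f z \<in> \<Inter> (set (snd (F k)))" for k
  proof (rule ccontr)
    assume "\<not> ?thesis"
    then have "f ` baire_cylinder (fst (F k)) \<inter> \<Inter> (set (snd (F k))) = {}"
      unfolding u by blast
    then show False using F(2)[of k] by (simp add: H_def hausdorff_measure_empty)
  qed
  then obtain y where y: "\<And>k. y k \<in> baire_cylinder (map m [0..<k])"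
    "\<And>k. f (y k) \<in> \<Inter> (set (snd (F k)))"
    by metis
  have "(\<lambda>k. f (y k)) \<longlonglongrightarrow> f m"
    using tendsto_baire_cylinder[OF y(1)] cont
    by (intro continuous_on_tendsto_compose[of UNIV f]) auto
  then have "f m \<in> Q j" for j
  proof (rule Lim_in_closed_set[rotated 3])
    show "closed (Q j)" using mnQ(3)[of j] by (auto simp: dyadic_cubes_def)
    show "eventually (\<lambda>k. f (y k) \<in> Q j) sequentially"
      using eventually_gt_at_top[of j] by eventually_elim (use y(2) q in blast)
  qed simp
  then have "f m \<in> fractal_level Z (n j) \<omega>" for j
    unfolding fractal_level_def using mnQ(3,4) by blast
  \<comment> \<open>The orders \<open>n j\<close> need not increase; \<open>j \<le> n j\<close>
    suffices to find one in every tail.\<close>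
  then have "f m \<in> limsup_fractal Z \<omega>"
    unfolding limsup_fractal_def using mnQ(2) by blast
  then show ?thesis by blast
qed

section \<open>Passage from all pairs of cylinders and cube lists to the analytic set\<close>

lemma (in random_cubes) AE_limsup_fractal_hits:
  assumes corr: "correlation_condition M Z \<delta>" and "\<delta> \<ge> 0"
    and G: "analytic_set G" "G \<subseteq> cbox 0 1"
    and dim: "index_min M Z + ereal \<delta> < hausdorff_dim G"
  shows "AE \<omega> in M. limsup_fractal Z \<omega> \<inter> G \<noteq> {}"
proof -
  obtain s where s: "index_min M Z + ereal \<delta> < ereal s" "ereal s < hausdorff_dim G"
    using ereal_dense2[OF dim] by auto
  have "0 \<le> index_min M Z + ereal \<delta>"
    using index_min_nonneg \<open>\<delta> \<ge> 0\<close> by simp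
  then have "0 < s"
    using s(1) by (metis ereal_less(2) order_le_less_trans)
  then have pos: "hausdorff_measure s G \<noteq> 0"
    using s(2) by (intro hausdorff_measure_nonzero) auto
  then obtain f :: "(nat \<Rightarrow> nat) \<Rightarrow> real ^ 'd" where f: "continuous_on UNIV f" "G = range f"
    using G(1) unfolding analytic_set_def by (auto simp: hausdorff_measure_empty)
  \<comment> \<open>The implication holds vacuously for null sets, so it can be required for all of
    the countably many pairs of a word and a cube list, with one exceptional null set.\<close>
  define P where "P \<omega> E \<longleftrightarrow> (hausdorff_measure s E \<noteq> 0 \<longrightarrow>
      (\<forall>N. \<exists>n\<ge>N. \<exists>Q\<in>dyadic_cubes n. Z n Q \<omega> = 1 \<and> hausdorff_measure s (E \<inter> Q) \<noteq> 0))" for \<omega> E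
  have "AE \<omega> in M. P \<omega> (f ` baire_cylinder u \<inter> \<Inter> (set qs))" for u qs
  proof (cases "hausdorff_measure s (f ` baire_cylinder u \<inter> \<Inter> (set qs)) = 0")
    case False
    have "f ` baire_cylinder u \<inter> \<Inter> (set qs) \<subseteq> cbox 0 1"
      using G(2) f(2) by blast
    from AE_infinitely_many_large_hits[OF corr \<open>\<delta> \<ge> 0\<close> s(1) this False]
    show ?thesis unfolding P_def by (auto elim: eventually_mono)
  qed (simp add: P_def)
  then have "AE \<omega> in M. \<forall>uq\<in>UNIV \<times> lists (\<Union>n. dyadic_cubes n).
      P \<omega> (f ` baire_cylinder (fst uq) \<inter> \<Inter> (set (snd uq)))"
    by (intro AE_ball_countable' countable_SIGMA countable_lists countable_all_dyadic_cubes) auto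
  then show ?thesis
  proof eventually_elim
    case (elim \<omega>)
    show ?case
      unfolding f(2)
    proof (rule limsup_hit_construction[OF f(1)])
      show "hausdorff_measure s (range f) \<noteq> 0" using pos f(2) by simp
    next
      fix u qs N
      assume "qs \<in> lists (\<Union>n. dyadic_cubes n)"
        and "hausdorff_measure s (f ` baire_cylinder u \<inter> \<Inter> (set qs)) \<noteq> 0"
      then show "\<exists>n\<ge>N. \<exists>Q\<in>dyadic_cubes n. Z n Q \<omega> = 1 \<and>
          hausdorff_measure s (f ` baire_cylinder u \<inter> \<Inter> (set qs) \<inter> Q) \<noteq> 0"
        using bspec[OF elim, of "(u, qs)"] by (simp add: P_def)
    qed
  qed
qed

section \<open>Both cases in the completed probability space\<close>

theorem theorem1p1:
  fixes M :: "'w measure"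
    and Z :: "nat \<Rightarrow> (real ^ 'd) set \<Rightarrow> 'w \<Rightarrow> real"
    and \<delta> :: real
    and G :: "(real ^ 'd) set"
  assumes "prob_space M"
    and "\<And>n Q. n \<ge> 1 \<Longrightarrow> Q \<in> dyadic_cubes n \<Longrightarrow> Z n Q \<in> borel_measurable M"
    and "\<And>n Q \<omega>. n \<ge> 1 \<Longrightarrow> Q \<in> dyadic_cubes n \<Longrightarrow> \<omega> \<in> space M \<Longrightarrow> Z n Q \<omega> \<in> {0, 1}"
    and "\<delta> \<ge> 0"
    and "correlation_condition M Z \<delta>"
    and "analytic_set G"
    and "G \<subseteq> cbox 0 1"
  shows "(packing_dim G < index_max M Z \<longrightarrow>
            {\<omega> \<in> space M. limsup_fractal Z \<omega> \<inter> G \<noteq> {}} \<in> sets (completion M) \<and>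
            measure (completion M) {\<omega> \<in> space M. limsup_fractal Z \<omega> \<inter> G \<noteq> {}} = 0) \<and>
         (hausdorff_dim G > index_min M Z + ereal \<delta> \<longrightarrow>
            {\<omega> \<in> space M. limsup_fractal Z \<omega> \<inter> G \<noteq> {}} \<in> sets (completion M) \<and>
            measure (completion M) {\<omega> \<in> space M. limsup_fractal Z \<omega> \<inter> G \<noteq> {}} = 1)"
proof -
  interpret random_cubes M Z
    using assms(1-3) by (intro random_cubes.intro random_cubes_axioms.intro) auto
  interpret completion: prob_space "completion M"
    by (rule prob_space_completion)
  let ?S = "{\<omega> \<in> space M. limsup_fractal Z \<omega> \<inter> G \<noteq> {}}"
  have space_diff: "space M - ?S = {\<omega> \<in> space M. \<not> (limsup_fractal Z \<omega> \<inter> G \<noteq> {})}"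
    by blast
  \<comment> \<open>The exceptional set of an almost sure statement lies in a null set of
    \<open>M\<close>, so it is measurable and null in the completion. This provides measurability of
    the hitting event along with its probability.\<close>
  have null: "{\<omega> \<in> space M. \<not> P \<omega>} \<in> null_sets (completion M)" if "AE \<omega> in M. P \<omega>" for P
    using that unfolding null_sets_completion_iff2 eventually_ae_filter by blast
  show ?thesis
  proof (intro conjI impI)
    assume "packing_dim G < index_max M Z"
    then obtain s T where sT: "ereal s < index_max M Z" "G \<subseteq> (\<Union>i :: nat. T i)"
      "\<And>i. packing_premeasure s (T i) < top"
      by (rule packing_dim_lessE) blast
    \<comment> \<open>Countably many pieces cover \<open>G\<close>, so their exceptional sets
      combine into one null set.\<close>
    then have "AE \<omega> in M. \<forall>i. limsup_fractal Z \<omega> \<inter> T i = {}"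
      unfolding AE_all_countable using AE_limsup_fractal_misses by blast
    then have "AE \<omega> in M. \<not> limsup_fractal Z \<omega> \<inter> G \<noteq> {}"
      by eventually_elim (use sT(2) in blast)
    from null[OF this] have "?S \<in> null_sets (completion M)" by simp
    then show "?S \<in> sets (completion M)" "measure (completion M) ?S = 0"
      by (auto simp: measure_eq_0_null_sets)
  next
    assume "hausdorff_dim G > index_min M Z + ereal \<delta>"
    then have "AE \<omega> in M. limsup_fractal Z \<omega> \<inter> G \<noteq> {}"
      by (intro AE_limsup_fractal_hits[OF assms(5,4,6,7)])
    from null[OF this] have N: "space M - ?S \<in> null_sets (completion M)"
      unfolding space_diff .
    have eq: "?S = space (completion M) - (space M - ?S)" by auto
    show "?S \<in> sets (completion M)"
      by (subst eq) (use N in auto)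
    show "measure (completion M) ?S = 1"
      using completion.prob_compl[of "space M - ?S"] N
      by (subst eq) (auto simp only: measure_eq_0_null_sets null_setsD2 diff_zero)
  qed
qed

end
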